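(* Let $Z$ be an $N\times N$ quaternionic Ginibre matrix. Then for all $n\ge1$, $\iota:\pm[n]\to[N]$ and $\eta:\pm[n]\to\{1,-1\}$, $$\mathbb{E}\Big(\prod_{k=1}^{n}Z_{\iota_k\iota_{-k};\eta_k\eta_{-k}}\Big)=\sum_{\substack{\alpha\in\mathrm{PM}(n)\\ \iota=\iota\circ\delta\alpha\\ \mathrm{sgn}\cdot\eta=(\mathrm{sgn}\circ\alpha)\cdot(\eta\circ\delta\alpha)}}\Big[\prod_{\substack{k\in[n]\\ -k\in\mathrm{FD}(\alpha)}}\eta_k\eta_{-k}\Big](2N)^{\#(\alpha)/2-n}f(\alpha),$$ where $f:\mathrm{PM}(n)\to\mathbb{C}$ is defined by $f(\alpha)=1$ if $\alpha\in\mathcal{P}_2(\pm[n])\cap S_{\mathrm{alt}}(\pm[n])$ and $f(\alpha)=0$ otherwise.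
   Context: A standard quaternionic Gaussian random variable is $\xi_0+i\xi_1+j\xi_2+k\xi_3$ with $\xi_0,\dots,\xi_3$ independent real $N(0,\tfrac14)$ variables. A quaternionic Ginibre matrix is $Z=\frac1{\sqrt N}G$ where $G$ is $N\times N$ with independent standard quaternionic Gaussian entries. The quaternion $a+bi+cj+dk$ is represented by the $2\times2$ complex matrix $\begin{pmatrix}a+bi&c+di\\-c+di&a-bi\end{pmatrix}$, rows and columns indexed by $1,-1$ in this order; $A_{\iota_1\iota_2;\eta_1\eta_2}$ is the $(\eta_1,\eta_2)$ entry of the matrix representing the quaternion $A_{\iota_1\iota_2}$. $[n]=\{1,\dots,n\}$, $\pm[n]=[n]\cup(-[n])$, $\delta:k\mapsto-k$, $\mathrm{sgn}(k)$ is the sign of the integer $k$, $\cdot$ is pointwise multiplication of functions, $\#(\alpha)$ is the number of orbits of $\alpha$ on $\pm[n]$. $\mathrm{PM}(n)$ is the set of permutations $\pi$ of $\pm[n]$ with $\delta\pi\delta=\pi^{-1}$ and no $k,-k$ in the same cycle. Its cycles come in pairs (order and signs reversed); $\mathrm{FD}(\pi)$ is the set of elements of those cycles, one from each pair, in which the element of smallest absolute value is positive. $\mathcal{P}_2(\pm[n])$ is the set of pairings (permutations all of whose cycles have exactly two elements). $S_{\mathrm{alt}}(\pm[n])$ is the set of alternating permutations: those $\pi$ for which $\pi(k)$ always has sign opposite to that of $k$. *)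

theory Defs
  imports
    "HOL-Probability.Probability"
    "HOL-Combinatorics.Permutations"
    "HOL-Combinatorics.Orbits"
begin

text \<open>
  The quaternion \<open>a + b i + c j + d k\<close> is the vector with components \<open>q $ 1 = a\<close>, \<open>q $ 2 = b\<close>,
  \<open>q $ 3 = c\<close>, \<open>q $ 4 = d\<close>. Only the real vector space structure and the Borel sets are used; the
  componentwise multiplication that the library puts on vectors is not the quaternion product.
\<close>

type_synonym quat = "real ^ 4"

text \<open>Rows and columns are indexed by \<open>1, -1\<close>, in this order; other arguments are meaningless.\<close>

definition quat_entry :: "quat \<Rightarrow> int \<Rightarrow> int \<Rightarrow> complex" where
  "quat_entry q r s =
     (if r = 1 then (if s = 1 then Complex (q $ 1) (q $ 2) else Complex (q $ 3) (q $ 4))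
      else (if s = 1 then Complex (- (q $ 3)) (q $ 4) else Complex (q $ 1) (- (q $ 2))))"

text \<open>The second parameter of \<open>normal_density\<close> is the standard deviation, so the variance is \<open>1/4\<close>.\<close>

definition std_quat_gaussian :: "'a measure \<Rightarrow> ('a \<Rightarrow> quat) \<Rightarrow> bool" where
  "std_quat_gaussian M X \<longleftrightarrow>
     prob_space.indep_vars M (\<lambda>_. borel) (\<lambda>m \<omega>. X \<omega> $ m) UNIV \<and>
     (\<forall>m. distributed M lborel (\<lambda>\<omega>. X \<omega> $ m) (\<lambda>x. ennreal (normal_density 0 (1/2) x)))"

text \<open>An \<open>N \<times> N\<close> random matrix is given by its entries with row and column index in \<open>{1..N}\<close>.\<close>

definition quat_ginibre :: "'a measure \<Rightarrow> nat \<Rightarrow> (nat \<Rightarrow> nat \<Rightarrow> 'a \<Rightarrow> quat) \<Rightarrow> bool" where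
  "quat_ginibre M N Z \<longleftrightarrow>
     (\<exists>G. prob_space.indep_vars M (\<lambda>_. borel) (\<lambda>(i, j). G i j) ({1..N} \<times> {1..N}) \<and>
          (\<forall>i\<in>{1..N}. \<forall>j\<in>{1..N}. std_quat_gaussian M (G i j)) \<and>
          (\<forall>i\<in>{1..N}. \<forall>j\<in>{1..N}. \<forall>\<omega>\<in>space M. Z i j \<omega> = (1 / sqrt (real N)) *\<^sub>R G i j \<omega>))"

definition pm_set :: "nat \<Rightarrow> int set" where
  "pm_set n = {1..int n} \<union> uminus ` {1..int n}"

text \<open>
  A permutation of a set is a function on all integers that is the identity off the set, and
  \<open>\<delta>\<close> is \<open>uminus\<close>. On a finite set the cycle of \<open>\<pi>\<close> through \<open>k\<close> is \<open>orbit \<pi> k\<close>.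
\<close>

definition PM :: "nat \<Rightarrow> (int \<Rightarrow> int) set" where
  "PM n = {\<pi>. \<pi> permutes pm_set n \<and> uminus \<circ> \<pi> \<circ> uminus = inv \<pi> \<and>
              (\<forall>k\<in>pm_set n. - k \<notin> orbit \<pi> k)}"

definition num_orbits :: "nat \<Rightarrow> (int \<Rightarrow> int) \<Rightarrow> nat" where
  "num_orbits n \<alpha> = card (orbit \<alpha> ` pm_set n)"

definition FD :: "nat \<Rightarrow> (int \<Rightarrow> int) \<Rightarrow> int set" where
  "FD n \<pi> = {k\<in>pm_set n. \<exists>m\<in>orbit \<pi> k. (\<forall>l\<in>orbit \<pi> k. \<bar>m\<bar> \<le> \<bar>l\<bar>) \<and> 0 < m}"

definition pairings :: "int set \<Rightarrow> (int \<Rightarrow> int) set" where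
  "pairings A = {\<pi>. \<pi> permutes A \<and> (\<forall>k\<in>A. card (orbit \<pi> k) = 2)}"

definition alternating_perms :: "int set \<Rightarrow> (int \<Rightarrow> int) set" where
  "alternating_perms A = {\<pi>. \<pi> permutes A \<and> (\<forall>k\<in>A. sgn (\<pi> k) = - sgn k)}"

definition ginibre_f :: "nat \<Rightarrow> (int \<Rightarrow> int) \<Rightarrow> complex" where
  "ginibre_f n \<alpha> = (if \<alpha> \<in> pairings (pm_set n) \<inter> alternating_perms (pm_set n) then 1 else 0)"

end

theory Submission
  imports Defs
begin

text \<open>
  The formula is Wick's formula for the Gaussian entries of \<open>Z\<close>, with the pairings of \<open>[n]\<close> written as
  permutations of \<open>[n] \<union> -[n]\<close>.

  Every entry of the complex matrix of a quaternion is a complex linear form in four independent real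
  normal variables. Hence the expectation of the product of the \<open>n\<close> entries is the sum over all
  pairings of \<open>[n]\<close> of the product, over the blocks, of the covariances of the two entries in a block
  (\<open>wick_formula\<close>). To prove this, each product of linear forms is expanded into monomials, whose
  expectations factor into moments of single variables. The moment recursion
  \<open>E X^(m+2) = (m + 1) v E X^m\<close> then removes from the set of factors its largest element together with a
  partner, and sums over pairings obey the same recursion (\<open>product_moment_insert\<close>,
  \<open>pairing_sum_insert\<close>).

  For the Ginibre matrix, two entries \<open>k\<close> and \<open>j\<close> have nonzero covariance only at the same position of
  \<open>Z\<close> and at opposite positions of the \<open>2 \<times> 2\<close> block, that is \<open>\<eta> j = - \<eta> k\<close> and
  \<open>\<eta> (- j) = - \<eta> (- k)\<close>; the covariance is then \<open>\<eta> k * \<eta> (- k) / (2 N)\<close> (\<open>ginibre_wick\<close>).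

  On the other side, \<open>f\<close> selects the alternating pairings in \<open>PM n\<close>. These are the permutations
  \<open>\<alpha> k = - p k\<close>, \<open>\<alpha> (- k) = p k\<close> for a pairing \<open>p\<close> of \<open>[n]\<close> (\<open>alternating_pairings_eq_lift\<close>). The
  constraints on \<open>\<iota>\<close> and \<open>\<eta>\<close> become the conditions for all covariances to be nonzero, \<open>\<alpha>\<close> has \<open>n\<close> cycles,
  which gives the power \<open>(2 N)^(- n/2)\<close>, and \<open>- k\<close> lies in \<open>FD n \<alpha>\<close> exactly when \<open>k\<close> is the larger element
  of its block, so that the sign is taken once for each block (\<open>prod_ginibre_covariance\<close>).
\<close>

section \<open>Sums over pairings\<close>

text \<open>
  A pairing of \<open>S\<close> is encoded as the map that exchanges the two elements of each block. Making it the
  identity off \<open>S\<close> gives every pairing exactly one such map, as sums over pairings require.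
\<close>

definition pairing_involutions :: "'k set \<Rightarrow> ('k \<Rightarrow> 'k) set" where
  "pairing_involutions S =
     {p. (\<forall>k. k \<notin> S \<longrightarrow> p k = k) \<and> (\<forall>k\<in>S. p k \<in> S \<and> p k \<noteq> k \<and> p (p k) = k)}"

lemma pairing_involutions_permutes:
  assumes "p \<in> pairing_involutions S"
  shows "p permutes S"
proof (rule bij_imp_permutes)
  show "bij_betw p S S"
    by (rule bij_betw_byWitness[where f' = p]) (use assms in \<open>auto simp: pairing_involutions_def\<close>)
qed (use assms in \<open>auto simp: pairing_involutions_def\<close>)

lemma finite_pairing_involutions: "finite S \<Longrightarrow> finite (pairing_involutions S)"
  by (rule finite_subset[OF _ finite_permutations]) (auto intro: pairing_involutions_permutes)

lemma pairing_involutions_empty: "pairing_involutions {} = {\<lambda>k. k}"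
  by (auto simp: pairing_involutions_def)

text \<open>
  Choosing the partner \<open>j\<close> of the new element \<open>r\<close> leaves an arbitrary pairing of \<open>S - {j}\<close>.
\<close>

lemma sum_pairing_involutions_insert:
  fixes F :: "('k \<Rightarrow> 'k) \<Rightarrow> 'b::comm_monoid_add"
  assumes "finite S" "r \<notin> S"
  shows "(\<Sum>p\<in>pairing_involutions (insert r S). F p) =
         (\<Sum>j\<in>S. \<Sum>q\<in>pairing_involutions (S - {j}). F (q(r := j, j := r)))"
proof -
  define detach where "detach p = (p r, p(r := r, p r := p r))" for p
  have "(\<Sum>j\<in>S. \<Sum>q\<in>pairing_involutions (S - {j}). F (q(r := j, j := r))) =
        (\<Sum>(j, q)\<in>(SIGMA j:S. pairing_involutions (S - {j})). F (q(r := j, j := r)))"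
    using assms by (intro sum.Sigma) (auto intro: finite_pairing_involutions)
  also have "\<dots> = (\<Sum>p\<in>pairing_involutions (insert r S). F p)"
  proof (rule sum.reindex_bij_witness[where i = detach and j = "\<lambda>(j, q). q(r := j, j := r)"])
    fix a assume "a \<in> (SIGMA j:S. pairing_involutions (S - {j}))"
    then obtain j q where a: "a = (j, q)" and j: "j \<in> S" "j \<noteq> r" and q: "q \<in> pairing_involutions (S - {j})"
      using assms by auto
    have fixed: "q r = r" "q j = j" using q assms by (auto simp: pairing_involutions_def)
    show "detach (case a of (j, q) \<Rightarrow> q(r := j, j := r)) = a"
      using fixed j by (auto simp: a detach_def fun_eq_iff)
    show "(case a of (j, q) \<Rightarrow> q(r := j, j := r)) \<in> pairing_involutions (insert r S)"
      using q j fixed assms unfolding a pairing_involutions_def by auto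
    show "F (case a of (j, q) \<Rightarrow> q(r := j, j := r)) = (case a of (j, q) \<Rightarrow> F (q(r := j, j := r)))"
      by (simp add: a)
  next
    fix p assume "p \<in> pairing_involutions (insert r S)"
    then have p: "\<And>k. k \<in> insert r S \<Longrightarrow> p k \<in> insert r S \<and> p k \<noteq> k \<and> p (p k) = k"
                 "\<And>k. k \<notin> insert r S \<Longrightarrow> p k = k"
      by (auto simp: pairing_involutions_def)
    show "(case detach p of (j, q) \<Rightarrow> q(r := j, j := r)) = p"
      using p(1)[of r] by (auto simp: detach_def fun_eq_iff)
    have "p r \<in> S" using p(1)[of r] by auto
    moreover have "p(r := r, p r := p r) \<in> pairing_involutions (S - {p r})"
      unfolding pairing_involutions_def mem_Collect_eq
    proof (intro conjI allI impI ballI)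
      fix k assume k: "k \<in> S - {p r}"
      then have k': "k \<in> insert r S" "k \<noteq> r" "k \<noteq> p r" using assms(2) by auto
      have r: "p (p r) = r" using p(1)[of r] by auto
      have pk: "p k \<in> insert r S" "p k \<noteq> k" "p (p k) = k" using p(1)[OF k'(1)] by auto
      have ne: "p k \<noteq> r" "p k \<noteq> p r" using k' r pk(3) by metis+
      have eq: "(p(r := r, p r := p r)) k = p k" using k' by simp
      show "(p(r := r, p r := p r)) k \<in> S - {p r}" unfolding eq using pk(1) ne by blast
      show "(p(r := r, p r := p r)) k \<noteq> k" unfolding eq by (rule pk(2))
      show "(p(r := r, p r := p r)) ((p(r := r, p r := p r)) k) = k"
        unfolding eq using ne pk(3) by simp
    next
      fix k assume "k \<notin> S - {p r}"
      then consider "k = r" | "k = p r" | "k \<notin> insert r S" by auto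
      then show "(p(r := r, p r := p r)) k = k" using p(2) by cases auto
    qed
    ultimately show "detach p \<in> (SIGMA j:S. pairing_involutions (S - {j}))"
      by (simp add: detach_def)
  qed
  finally show ?thesis by simp
qed

text \<open>
  Each block is visited once, through its larger element, which fixes the order of the arguments of the
  weight.
\<close>

definition pairing_sum :: "('k::linorder \<Rightarrow> 'k \<Rightarrow> 'b::comm_semiring_1) \<Rightarrow> 'k set \<Rightarrow> 'b" where
  "pairing_sum w S = (\<Sum>p\<in>pairing_involutions S. \<Prod>k | k \<in> S \<and> p k < k. w k (p k))"

lemma pairing_sum_empty: "pairing_sum w {} = 1"
  by (simp add: pairing_sum_def pairing_involutions_empty)

text \<open>
  As \<open>r\<close> exceeds every element of \<open>S\<close>, it is the larger element of its block and contributes \<open>w r j\<close>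
  with the arguments in this order.
\<close>

lemma pairing_sum_insert:
  assumes "finite S" "\<And>k. k \<in> S \<Longrightarrow> k < r"
  shows "pairing_sum w (insert r S) = (\<Sum>j\<in>S. w r j * pairing_sum w (S - {j}))"
proof -
  have r: "r \<notin> S" using assms by auto
  have "(\<Prod>k | k \<in> insert r S \<and> (q(r := j, j := r)) k < k. w k ((q(r := j, j := r)) k)) =
        w r j * (\<Prod>k | k \<in> S - {j} \<and> q k < k. w k (q k))"
    if j: "j \<in> S" for j and q :: "'a \<Rightarrow> 'a"
  proof -
    have "{k \<in> insert r S. (q(r := j, j := r)) k < k} = insert r {k \<in> S - {j}. q k < k}"
      using j r assms(2)[OF j] by auto
    moreover have "(\<Prod>k | k \<in> S - {j} \<and> q k < k. w k ((q(r := j, j := r)) k)) =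
                   (\<Prod>k | k \<in> S - {j} \<and> q k < k. w k (q k))"
      using r by (intro prod.cong) auto
    ultimately show ?thesis using assms(1) r j by auto
  qed
  then show ?thesis
    unfolding pairing_sum_def sum_pairing_involutions_insert[OF assms(1) r]
    by (simp add: sum_distrib_left)
qed

lemma pairing_sum_cong:
  assumes "\<And>k j. k \<in> S \<Longrightarrow> j \<in> S \<Longrightarrow> w k j = w' k j"
  shows "pairing_sum w S = pairing_sum w' S"
  unfolding pairing_sum_def using assms
  by (intro sum.cong prod.cong) (auto simp: pairing_involutions_def)

section \<open>Moments of normal variables\<close>

text \<open>
  The moments of the centred normal law of variance \<open>v\<close>, given by Gaussian integration by parts
  \<open>E X^(m+2) = (m + 1) v E X^m\<close>: this recursion, and not the closed form, matches the removal of one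
  block from a pairing.
\<close>

fun gaussian_moment :: "real \<Rightarrow> nat \<Rightarrow> real" where
  "gaussian_moment v 0 = 1"
| "gaussian_moment v (Suc 0) = 0"
| "gaussian_moment v (Suc (Suc m)) = real (Suc m) * v * gaussian_moment v m"

lemma gaussian_moment_Suc: "gaussian_moment v (Suc m) = real m * v * gaussian_moment v (m - 1)"
  by (cases m) auto

text \<open>
  The recursion produces the double factorial \<open>(2k - 1)!! = (2k)! / (2^k k!)\<close>.
\<close>

lemma gaussian_moment_even:
  "gaussian_moment (\<sigma>\<^sup>2) (2 * k) = fact (2 * k) / ((2 / \<sigma>\<^sup>2) ^ k * fact k)"
proof (induction k)
  case (Suc k)
  have "2 * Suc k = Suc (Suc (2 * k))" by simp
  then have "gaussian_moment (\<sigma>\<^sup>2) (2 * Suc k) =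
      (2 * real k + 1) * \<sigma>\<^sup>2 * (fact (2 * k) / ((2 / \<sigma>\<^sup>2) ^ k * fact k))"
    using Suc.IH by simp
  also have "\<dots> = fact (2 * Suc k) / ((2 / \<sigma>\<^sup>2) ^ Suc k * fact (Suc k))"
  proof (cases "\<sigma> = 0")
    case False
    have "((2::real) * real k + 1) * s * (a / (b * c)) = ((2 + 2 * real k) * ((1 + 2 * real k) * a)) / ((2 / s) * b * ((1 + real k) * c))"
      if "s > 0" for s a b c :: real
      using that by (simp add: divide_simps)
    from this[of "\<sigma>\<^sup>2"] False show ?thesis by simp
  qed simp
  finally show ?case .
qed simp

lemma gaussian_moment_odd: "gaussian_moment v (2 * k + 1) = 0"
  by (induction k) auto

lemma has_bochner_integral_normal_power:
  assumes "distributed M lborel X (\<lambda>x. ennreal (normal_density 0 \<sigma> x))" "0 < \<sigma>"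
  shows "has_bochner_integral M (\<lambda>\<omega>. X \<omega> ^ m) (gaussian_moment (\<sigma>\<^sup>2) m)"
proof -
  have "has_bochner_integral lborel (\<lambda>x. normal_density 0 \<sigma> x * x ^ m) (gaussian_moment (\<sigma>\<^sup>2) m)"
  proof (cases "even m")
    case True
    then obtain k where "m = 2 * k" by auto
    then show ?thesis using normal_moment_even[OF assms(2), of 0 k] gaussian_moment_even by simp
  next
    case False
    then obtain k where "m = 2 * k + 1" by (auto elim: oddE)
    then show ?thesis
      using normal_moment_odd[OF assms(2), of 0 k] gaussian_moment_odd[of "\<sigma>\<^sup>2" k] by simp
  qed
  then show ?thesis
    using distributed_integrable[OF assms(1), of "\<lambda>x. x ^ m"]
      distributed_integral[OF assms(1), of "\<lambda>x. x ^ m"]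
    by (simp add: has_bochner_integral_iff)
qed

section \<open>Wick's formula\<close>

text \<open>
  The expectation of \<open>\<Prod>k\<in>S. X (f k)\<close> for independent centred normal variables \<open>X e\<close> of variance \<open>v\<close>:
  the variable \<open>X e\<close> occurs with the multiplicity of \<open>e\<close> among the values of \<open>f\<close>.
\<close>

definition monomial_moment :: "real \<Rightarrow> 'e set \<Rightarrow> 'k set \<Rightarrow> ('k \<Rightarrow> 'e) \<Rightarrow> real" where
  "monomial_moment v E S f = (\<Prod>e\<in>E. gaussian_moment v (card {k \<in> S. f k = e}))"

lemma monomial_moment_cong:
  "(\<And>k. k \<in> S \<Longrightarrow> f k = g k) \<Longrightarrow> monomial_moment v E S f = monomial_moment v E S g"
  unfolding monomial_moment_def by (intro prod.cong arg_cong[of _ _ "gaussian_moment v"] arg_cong[of _ _ card]) auto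

text \<open>
  If \<open>m\<close> elements of \<open>S\<close> carry the label \<open>f r\<close>, the factor for this label is the moment of order
  \<open>m + 1\<close>, which is \<open>m v\<close> times the moment of order \<open>m - 1\<close>; the \<open>m\<close> equal terms are the possible
  partners \<open>j\<close> of \<open>r\<close>.
\<close>

lemma monomial_moment_insert:
  assumes "finite E" "finite S" "r \<notin> S" "f r \<in> E"
  shows "monomial_moment v E (insert r S) f =
         (\<Sum>j | j \<in> S \<and> f j = f r. v * monomial_moment v E (S - {j}) f)"
proof -
  define n where "n e = card {k \<in> S. f k = e}" for e
  let ?R = "\<Prod>e\<in>E - {f r}. gaussian_moment v (n e)"
  have eq: "{k. (k = r \<or> k \<in> S) \<and> f k = e} = (if e = f r then insert r {k \<in> S. f k = e} else {k \<in> S. f k = e})" for e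
    by auto
  have "card {k \<in> insert r S. f k = e} = (if e = f r then Suc (n e) else n e)" for e
    using assms by (auto simp: n_def eq)
  then have lhs: "monomial_moment v E (insert r S) f = gaussian_moment v (Suc (n (f r))) * ?R"
    unfolding monomial_moment_def using assms
    by (subst prod.remove[of E "f r"]) (auto intro!: prod.cong)
  have rhs: "monomial_moment v E (S - {j}) f = gaussian_moment v (n (f r) - 1) * ?R"
    if "j \<in> S" "f j = f r" for j
  proof -
    have eq: "{k. k \<in> S \<and> k \<noteq> j \<and> f k = e} = (if e = f r then {k \<in> S. f k = e} - {j} else {k \<in> S. f k = e})" for e
      using that by auto
    have "card {k \<in> S - {j}. f k = e} = (if e = f r then n e - 1 else n e)" for e
      using assms that by (auto simp: n_def eq card_Diff_singleton)
    then show ?thesis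
      unfolding monomial_moment_def using assms
      by (subst prod.remove[of E "f r"]) (auto intro!: prod.cong)
  qed
  have "(\<Sum>j | j \<in> S \<and> f j = f r. v * monomial_moment v E (S - {j}) f) =
        real (n (f r)) * (v * (gaussian_moment v (n (f r) - 1) * ?R))"
    by (simp add: rhs n_def)
  then show ?thesis unfolding lhs gaussian_moment_Suc by simp
qed

lemma sum_PiE_insert:
  fixes F :: "('k \<Rightarrow> 'e) \<Rightarrow> 'b::comm_monoid_add"
  assumes "r \<notin> S"
  shows "(\<Sum>f\<in>insert r S \<rightarrow>\<^sub>E E. F f) = (\<Sum>e\<in>E. \<Sum>f\<in>S \<rightarrow>\<^sub>E E. F (f(r := e)))"
proof -
  have inj: "inj_on (\<lambda>(y, g). g(r := y)) (E \<times> (S \<rightarrow>\<^sub>E E))"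
    using assms by (rule inj_combinator)
  have "(\<Sum>f\<in>insert r S \<rightarrow>\<^sub>E E. F f) = (\<Sum>(e, f)\<in>E \<times> (S \<rightarrow>\<^sub>E E). F (f(r := e)))"
    unfolding PiE_insert_eq by (subst sum.reindex[OF inj]) (auto intro!: sum.cong)
  then show ?thesis by (simp add: sum.cartesian_product)
qed

text \<open>
  The expectation of \<open>\<Prod>k\<in>S. \<Sum>e\<in>E. c k e * X e\<close> after the product of sums is expanded into monomials.
\<close>

definition product_moment :: "real \<Rightarrow> 'e set \<Rightarrow> ('k \<Rightarrow> 'e \<Rightarrow> complex) \<Rightarrow> 'k set \<Rightarrow> complex" where
  "product_moment v E c S = (\<Sum>f\<in>S \<rightarrow>\<^sub>E E. (\<Prod>k\<in>S. c k (f k)) * of_real (monomial_moment v E S f))"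

text \<open>
  Summing the recursion for monomials against the coefficients: fixing a partner \<open>j\<close> of \<open>r\<close> forces the
  labels of \<open>j\<close> and \<open>r\<close> to agree, and the sum over the common label is the covariance of the two
  linear forms, while the labels of \<open>S - {j}\<close> remain free.
\<close>

lemma product_moment_insert:
  assumes "finite E" "finite S" "r \<notin> S"
  shows "product_moment v E c (insert r S) =
         (\<Sum>j\<in>S. (\<Sum>e\<in>E. of_real v * c r e * c j e) * product_moment v E c (S - {j}))"
proof -
  let ?m = "\<lambda>S f. complex_of_real (monomial_moment v E S f)"
  have upd: "(\<Prod>k\<in>S. c k ((f(r := e)) k)) = (\<Prod>k\<in>S. c k (f k))" if "r \<notin> S" for S f r e
    using that by (intro prod.cong) auto
  have updm: "?m S (f(r := e)) = ?m S f" if "r \<notin> S" for S f r e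
    using that by (subst monomial_moment_cong[of S "f(r := e)" f]) auto
  have "product_moment v E c (insert r S) = (\<Sum>e\<in>E. \<Sum>f\<in>S \<rightarrow>\<^sub>E E.
          c r e * (\<Prod>k\<in>S. c k (f k)) * (\<Sum>j | j \<in> S \<and> f j = e. of_real v * ?m (S - {j}) f))"
    unfolding product_moment_def sum_PiE_insert[OF assms(3)]
  proof (intro sum.cong refl)
    fix e f assume e: "e \<in> E"
    have "{j \<in> S. (f(r := e)) j = (f(r := e)) r} = {j \<in> S. f j = e}" using assms by auto
    then have "?m (insert r S) (f(r := e)) = (\<Sum>j | j \<in> S \<and> f j = e. of_real v * ?m (S - {j}) f)"
      using assms e by (subst monomial_moment_insert) (auto simp: updm)
    then show "(\<Prod>k\<in>insert r S. c k ((f(r := e)) k)) * ?m (insert r S) (f(r := e)) =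
       c r e * (\<Prod>k\<in>S. c k (f k)) * (\<Sum>j | j \<in> S \<and> f j = e. of_real v * ?m (S - {j}) f)"
      using assms upd[of r S f e] by (simp del: fun_upd_apply) simp
  qed
  also have "\<dots> = (\<Sum>e\<in>E. \<Sum>f\<in>S \<rightarrow>\<^sub>E E. \<Sum>j\<in>S. if f j = e then
                     of_real v * c r e * (\<Prod>k\<in>S. c k (f k)) * ?m (S - {j}) f else 0)"
    using assms by (intro sum.cong refl) (auto simp: sum_distrib_left sum.inter_filter[symmetric] mult_ac)
  also have "\<dots> = (\<Sum>e\<in>E. \<Sum>j\<in>S. \<Sum>f\<in>S \<rightarrow>\<^sub>E E. if f j = e then
                     of_real v * c r e * (\<Prod>k\<in>S. c k (f k)) * ?m (S - {j}) f else 0)"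
    by (intro sum.cong refl sum.swap)
  also have "\<dots> = (\<Sum>j\<in>S. \<Sum>e\<in>E. \<Sum>f\<in>S \<rightarrow>\<^sub>E E. if f j = e then
                     of_real v * c r e * (\<Prod>k\<in>S. c k (f k)) * ?m (S - {j}) f else 0)"
    by (rule sum.swap)
  also have "\<dots> = (\<Sum>j\<in>S. \<Sum>e\<in>E. of_real v * c r e * c j e * product_moment v E c (S - {j}))"
  proof (intro sum.cong refl)
    fix j e assume j: "j \<in> S" and e: "e \<in> E"
    then have S: "S = insert j (S - {j})" by auto
    \<comment> \<open>Split off the label \<open>e'\<close> of \<open>j\<close>; only \<open>e' = e\<close> survives.\<close>
    have "(\<Sum>f\<in>S \<rightarrow>\<^sub>E E. if f j = e then of_real v * c r e * (\<Prod>k\<in>S. c k (f k)) * ?m (S - {j}) f else 0) =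
          (\<Sum>e'\<in>E. \<Sum>f\<in>(S - {j}) \<rightarrow>\<^sub>E E. if e' = e then of_real v * c r e * (c j e * (\<Prod>k\<in>S - {j}. c k (f k))) * ?m (S - {j}) f else 0)"
      apply (subst (1) S, subst sum_PiE_insert)
       apply simp
      apply (intro sum.cong refl)
      subgoal for e' f
        using prod.remove[OF assms(2) j, of "\<lambda>k. c k ((f(j := e)) k)"] upd[of j "S - {j}" f e] updm[of j "S - {j}" f e]
        by (simp del: fun_upd_apply) simp
      done
    also have "\<dots> = (\<Sum>f\<in>(S - {j}) \<rightarrow>\<^sub>E E. of_real v * c r e * (c j e * (\<Prod>k\<in>S - {j}. c k (f k))) * ?m (S - {j}) f)"
      using assms(1) e by (subst sum.swap) (simp add: sum.delta)
    finally show "(\<Sum>f\<in>S \<rightarrow>\<^sub>E E. if f j = e then of_real v * c r e * (\<Prod>k\<in>S. c k (f k)) * ?m (S - {j}) f else 0) =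
          of_real v * c r e * c j e * product_moment v E c (S - {j})"
      unfolding product_moment_def by (simp add: sum_distrib_left mult_ac)
  qed
  finally show ?thesis by (simp add: sum_distrib_right)
qed

text \<open>
  Both sides satisfy the same recursion in the largest element of \<open>S\<close>.
\<close>

lemma product_moment_eq_pairing_sum:
  fixes S :: "'k::linorder set"
  assumes "finite E" "finite S"
  shows "product_moment v E c S = pairing_sum (\<lambda>k j. \<Sum>e\<in>E. of_real v * c k e * c j e) S"
  using assms(2)
proof (induction "card S" arbitrary: S rule: less_induct)
  case less
  show ?case
  proof (cases "S = {}")
    case True
    then show ?thesis
      by (simp add: pairing_sum_empty product_moment_def monomial_moment_def)
  next
    case False
    define r where "r = Max S"
    define T where "T = S - {r}"
    have "r \<in> S" using less.prems False by (simp add: r_def)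
    then have S: "S = insert r T" "r \<notin> T" "finite T" using less.prems by (auto simp: T_def)
    have lt: "k < r" if "k \<in> T" for k
      using that less.prems by (auto simp: T_def r_def order.strict_iff_order)
    have "card (T - {j}) < card S" for j
      unfolding S(1) using S(2,3) card_Diff1_le[of T j] by simp
    then have "product_moment v E c (T - {j}) =
               pairing_sum (\<lambda>k j. \<Sum>e\<in>E. of_real v * c k e * c j e) (T - {j})" for j
      using less.hyps S(3) by blast
    then show ?thesis
      unfolding S(1) using S lt assms(1) by (simp add: product_moment_insert pairing_sum_insert)
  qed
qed

text \<open>
  Wick's formula for complex linear forms in independent centred normal variables of variance \<open>v\<close>.
  Independence is expressed by the factorisation of the mixed moments of the \<open>X e\<close>. The weight of
  a block is the covariance of its two forms, because the expectation is multilinear in the forms. These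
  covariances are bilinear in the coefficients, with no complex conjugation.
\<close>

lemma wick_formula:
  fixes S :: "'k::linorder set" and X :: "'e \<Rightarrow> 'a \<Rightarrow> real" and c :: "'k \<Rightarrow> 'e \<Rightarrow> complex"
  assumes "finite E" "finite S"
    and moments: "\<And>a. has_bochner_integral M (\<lambda>\<omega>. \<Prod>e\<in>E. X e \<omega> ^ a e) (\<Prod>e\<in>E. gaussian_moment v (a e))"
  shows "has_bochner_integral M (\<lambda>\<omega>. \<Prod>k\<in>S. \<Sum>e\<in>E. c k e * of_real (X e \<omega>))
           (pairing_sum (\<lambda>k j. \<Sum>e\<in>E. of_real v * c k e * c j e) S)"
proof -
  have "(\<Prod>k\<in>S. X (f k) \<omega>) = (\<Prod>e\<in>E. X e \<omega> ^ card {k \<in> S. f k = e})" if "f \<in> S \<rightarrow>\<^sub>E E" for f \<omega>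
  proof -
    have "(\<Prod>k\<in>S. X (f k) \<omega>) = (\<Prod>e\<in>E. \<Prod>k | k \<in> S \<and> f k = e. X (f k) \<omega>)"
      by (rule prod.group[symmetric]) (use assms that in auto)
    also have "\<dots> = (\<Prod>e\<in>E. \<Prod>k | k \<in> S \<and> f k = e. X e \<omega>)"
      by (intro prod.cong) auto
    finally show ?thesis by simp
  qed
  then have "has_bochner_integral M (\<lambda>\<omega>. \<Prod>k\<in>S. X (f k) \<omega>) (monomial_moment v E S f)"
    if "f \<in> S \<rightarrow>\<^sub>E E" for f
    using that moments[of "\<lambda>e. card {k \<in> S. f k = e}"] by (simp add: monomial_moment_def)
  then have "has_bochner_integral M
      (\<lambda>\<omega>. \<Sum>f\<in>S \<rightarrow>\<^sub>E E. (\<Prod>k\<in>S. c k (f k)) * of_real (\<Prod>k\<in>S. X (f k) \<omega>)) (product_moment v E c S)"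
    unfolding product_moment_def
    by (intro has_bochner_integral_sum has_bochner_integral_mult_right has_bochner_integral_of_real)
  then show ?thesis
    using assms by (simp add: prod_sum_PiE prod.distrib product_moment_eq_pairing_sum)
qed

section \<open>Moments of independent Gaussian quaternions\<close>

lemma (in prob_space) has_bochner_integral_prod_indep_vars:
  fixes X :: "'i \<Rightarrow> 'a \<Rightarrow> real"
  assumes "finite I" "indep_vars (\<lambda>_. borel) X I"
    and "\<And>i. i \<in> I \<Longrightarrow> has_bochner_integral M (X i) (x i)"
  shows "has_bochner_integral M (\<lambda>\<omega>. \<Prod>i\<in>I. X i \<omega>) (\<Prod>i\<in>I. x i)"
proof -
  have "integrable M (X i)" "integral\<^sup>L M (X i) = x i" if "i \<in> I" for i
    using assms(3)[OF that] by (simp_all add: has_bochner_integral_iff)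
  then show ?thesis
    using indep_vars_integrable[OF assms(1,2)] indep_vars_lebesgue_integral[OF assms(1,2)]
    by (simp add: has_bochner_integral_iff)
qed

lemma (in prob_space) quat_gaussian_mixed_moments:
  assumes "std_quat_gaussian M X"
  shows "has_bochner_integral M (\<lambda>\<omega>. \<Prod>m\<in>UNIV. (X \<omega> $ m) ^ a m) (\<Prod>m\<in>UNIV. gaussian_moment (1/4) (a m))"
proof (rule has_bochner_integral_prod_indep_vars)
  show "indep_vars (\<lambda>_. borel) (\<lambda>m \<omega>. (X \<omega> $ m) ^ a m) UNIV"
    using assms unfolding std_quat_gaussian_def
    by (intro indep_vars_compose2[where X = "\<lambda>m \<omega>. X \<omega> $ m" and Y = "\<lambda>m x. x ^ a m" and M' = "\<lambda>_. borel"]) auto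
  show "has_bochner_integral M (\<lambda>\<omega>. (X \<omega> $ m) ^ a m) (gaussian_moment (1/4) (a m))" for m
    using assms has_bochner_integral_normal_power[of M "\<lambda>\<omega>. X \<omega> $ m" "1/2" "a m"]
    by (simp add: std_quat_gaussian_def power2_eq_square)
qed simp

text \<open>
  A mixed moment factors first over the independent quaternions, and then over the four independent
  components of each one.
\<close>

lemma (in prob_space) indep_quat_gaussian_mixed_moments:
  fixes X :: "'i \<Rightarrow> 'a \<Rightarrow> quat"
  assumes "finite I" "indep_vars (\<lambda>_. borel) X I" "\<And>i. i \<in> I \<Longrightarrow> std_quat_gaussian M (X i)"
  shows "has_bochner_integral M (\<lambda>\<omega>. \<Prod>e\<in>I \<times> UNIV. (X (fst e) \<omega> $ snd e) ^ a e)
           (\<Prod>e\<in>I \<times> UNIV. gaussian_moment (1/4) (a e))"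
proof -
  have "indep_vars (\<lambda>_. borel) (\<lambda>i \<omega>. \<Prod>m\<in>UNIV. (X i \<omega> $ m) ^ a (i, m)) I"
    by (rule indep_vars_compose2[OF assms(2), where Y = "\<lambda>i x. \<Prod>m\<in>UNIV. (x $ m) ^ a (i, m)"]) simp
  then have "has_bochner_integral M (\<lambda>\<omega>. \<Prod>i\<in>I. \<Prod>m\<in>UNIV. (X i \<omega> $ m) ^ a (i, m))
               (\<Prod>i\<in>I. \<Prod>m\<in>UNIV. gaussian_moment (1/4) (a (i, m)))"
    using assms by (intro has_bochner_integral_prod_indep_vars quat_gaussian_mixed_moments)
  then show ?thesis
    by (simp add: prod.cartesian_product split_def)
qed

section \<open>Covariances of the Ginibre matrix\<close>

text \<open>
  Each entry of the matrix of a quaternion is a complex linear form in its four real components, with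
  the corresponding entries of the units \<open>1, i, j, k\<close> as coefficients.
\<close>

lemma quat_entry_eq_sum:
  "quat_entry q r s = (\<Sum>m\<in>UNIV. quat_entry (axis m 1) r s * of_real (q $ m))"
  by (simp add: quat_entry_def sum_4 axis_def complex_eq_iff)

lemma quat_entry_scaleR: "quat_entry (a *\<^sub>R q) r s = of_real a * quat_entry q r s"
  by (simp add: quat_entry_def complex_eq_iff)

text \<open>
  The bilinear pairing of two coefficient vectors. For a quaternion with matrix rows \<open>(u, v)\<close> and
  \<open>(- cnj v, cnj u)\<close> only \<open>u\<close> with \<open>cnj u\<close>, and \<open>v\<close> with \<open>- cnj v\<close>, are correlated, which are the pairs
  of opposite entries; the sign of the covariance is \<open>+\<close> on the diagonal and \<open>-\<close> off it.
\<close>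

lemma sum_quat_entry_axis:
  assumes "r \<in> {1, -1}" "s \<in> {1, -1}" "r' \<in> {1, -1}" "s' \<in> {1, -1}"
  shows "(\<Sum>m\<in>UNIV. quat_entry (axis m 1) r s * quat_entry (axis m 1) r' s') =
         (if r' = - r \<and> s' = - s then 2 * of_int (r * s) else 0)"
  using assms by (auto simp: quat_entry_def sum_4 axis_def complex_eq_iff)

text \<open>
  The expectation of the product of the entries of \<open>Z\<close> numbered \<open>k\<close> and \<open>j\<close>.
\<close>

definition ginibre_covariance ::
    "nat \<Rightarrow> (int \<Rightarrow> nat) \<Rightarrow> (int \<Rightarrow> int) \<Rightarrow> int \<Rightarrow> int \<Rightarrow> complex" where
  "ginibre_covariance N \<iota> \<eta> k j =
     (if \<iota> k = \<iota> j \<and> \<iota> (- k) = \<iota> (- j) \<and> \<eta> j = - \<eta> k \<and> \<eta> (- j) = - \<eta> (- k)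
      then of_int (\<eta> k * \<eta> (- k)) / of_nat (2 * N) else 0)"

text \<open>
  The matrix elements are linear forms in the real variables indexed by a position in the \<open>N \<times> N\<close>
  matrix and a component. Covariances between different positions vanish; at equal positions the
  variance \<open>1/4\<close> and the two factors \<open>1 / sqrt N\<close> turn \<open>2 \<eta> k * \<eta> (- k)\<close> into \<open>\<eta> k * \<eta> (- k) / (2 N)\<close>.
\<close>

lemma ginibre_wick:
  fixes S :: "int set"
  assumes "prob_space M" "quat_ginibre M N Z" "finite S"
    and \<iota>: "\<And>k. k \<in> S \<Longrightarrow> \<iota> k \<in> {1..N} \<and> \<iota> (- k) \<in> {1..N}"
    and \<eta>: "\<And>k. k \<in> S \<Longrightarrow> \<eta> k \<in> {1, -1} \<and> \<eta> (- k) \<in> {1, -1}"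
  shows "has_bochner_integral M
           (\<lambda>\<omega>. \<Prod>k\<in>S. quat_entry (Z (\<iota> k) (\<iota> (- k)) \<omega>) (\<eta> k) (\<eta> (- k)))
           (pairing_sum (ginibre_covariance N \<iota> \<eta>) S)"
proof -
  interpret prob_space M by fact
  obtain G where indep: "indep_vars (\<lambda>_. borel) (\<lambda>(i, j). G i j) ({1..N} \<times> {1..N})"
    and gauss: "\<And>i j. i \<in> {1..N} \<Longrightarrow> j \<in> {1..N} \<Longrightarrow> std_quat_gaussian M (G i j)"
    and Z: "\<And>i j \<omega>. i \<in> {1..N} \<Longrightarrow> j \<in> {1..N} \<Longrightarrow> \<omega> \<in> space M \<Longrightarrow> Z i j \<omega> = (1 / sqrt (real N)) *\<^sub>R G i j \<omega>"
    using assms(2) unfolding quat_ginibre_def by blast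
  define P where "P = {1..N} \<times> {1..N}"
  define H where "H = (\<lambda>(i, j). G i j)"
  define pos where "pos k = (\<iota> k, \<iota> (- k))" for k
  define b where "b k m = of_real (1 / sqrt (real N)) * quat_entry (axis m 1) (\<eta> k) (\<eta> (- k))" for k and m :: 4
  define c where "c k e = (if fst e = pos k then b k (snd e) else 0)" for k and e :: "(nat \<times> nat) \<times> 4"
  have pos: "pos k \<in> P" if "k \<in> S" for k
    using \<iota>[OF that] by (simp add: pos_def P_def)
  have sum_P: "(\<Sum>e\<in>P \<times> UNIV. if fst e = p then g (snd e) else 0) = (\<Sum>m\<in>UNIV. g m)"
    if "p \<in> P" for p and g :: "4 \<Rightarrow> complex"
  proof -
    have "(\<Sum>e\<in>P \<times> UNIV. if fst e = p then g (snd e) else 0) = (\<Sum>q\<in>P. \<Sum>m\<in>UNIV. if q = p then g m else 0)"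
      by (simp add: sum.cartesian_product split_def)
    also have "\<dots> = (\<Sum>q\<in>P. if q = p then (\<Sum>m\<in>UNIV. g m) else 0)"
      by (intro sum.cong) auto
    also have "\<dots> = (\<Sum>m\<in>UNIV. g m)"
      using that by (simp add: P_def)
    finally show ?thesis .
  qed
  have entry: "quat_entry (Z (\<iota> k) (\<iota> (- k)) \<omega>) (\<eta> k) (\<eta> (- k)) =
        (\<Sum>e\<in>P \<times> UNIV. c k e * of_real (H (fst e) \<omega> $ snd e))"
    if "k \<in> S" "\<omega> \<in> space M" for k \<omega>
  proof -
    have "(\<Sum>e\<in>P \<times> UNIV. c k e * of_real (H (fst e) \<omega> $ snd e)) =
          (\<Sum>e\<in>P \<times> UNIV. if fst e = pos k then b k (snd e) * of_real (H (pos k) \<omega> $ snd e) else 0)"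
      by (intro sum.cong) (auto simp: c_def)
    also have "\<dots> = (\<Sum>m\<in>UNIV. b k m * of_real (H (pos k) \<omega> $ m))"
      by (rule sum_P[OF pos[OF that(1)]])
    also have "\<dots> = of_real (1 / sqrt (real N)) * quat_entry (H (pos k) \<omega>) (\<eta> k) (\<eta> (- k))"
      by (subst quat_entry_eq_sum) (simp add: b_def sum_distrib_left mult_ac)
    also have "\<dots> = quat_entry (Z (\<iota> k) (\<iota> (- k)) \<omega>) (\<eta> k) (\<eta> (- k))"
      using Z[of "\<iota> k" "\<iota> (- k)" \<omega>] \<iota>[OF that(1)] that(2)
      by (simp add: H_def pos_def quat_entry_scaleR del: of_real_divide)
    finally show ?thesis by simp
  qed
  have cov: "(\<Sum>e\<in>P \<times> UNIV. of_real (1/4) * c k e * c j e) = ginibre_covariance N \<iota> \<eta> k j"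
    if "k \<in> S" "j \<in> S" for k j
  proof (cases "pos j = pos k")
    case True
    have N: "complex_of_real (sqrt (real N)) * complex_of_real (sqrt (real N)) = of_nat N"
      by (simp flip: of_real_mult)
    have "(\<Sum>e\<in>P \<times> UNIV. of_real (1/4) * c k e * c j e) =
          (\<Sum>e\<in>P \<times> UNIV. if fst e = pos k then of_real (1/4) * b k (snd e) * b j (snd e) else 0)"
      by (intro sum.cong) (auto simp: c_def True)
    also have "\<dots> = (\<Sum>m\<in>UNIV. of_real (1/4) * b k m * b j m)"
      by (rule sum_P[OF pos[OF that(1)]])
    also have "\<dots> = 1 / of_nat (4 * N) *
        (\<Sum>m\<in>UNIV. quat_entry (axis m 1) (\<eta> k) (\<eta> (- k)) * quat_entry (axis m 1) (\<eta> j) (\<eta> (- j)))"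
      by (simp add: b_def sum_distrib_left mult_ac flip: N)
    also have "\<dots> = ginibre_covariance N \<iota> \<eta> k j"
      using True \<eta>[OF that(1)] \<eta>[OF that(2)]
      by (subst sum_quat_entry_axis) (auto simp: ginibre_covariance_def pos_def)
    finally show ?thesis .
  next
    case False
    then have "of_real (1/4) * c k e * c j e = 0" for e by (auto simp: c_def)
    moreover have "ginibre_covariance N \<iota> \<eta> k j = 0"
      using False by (auto simp: ginibre_covariance_def pos_def)
    ultimately show ?thesis by (simp only: sum.neutral_const)
  qed
  have "has_bochner_integral M (\<lambda>\<omega>. \<Prod>k\<in>S. \<Sum>e\<in>P \<times> UNIV. c k e * of_real (H (fst e) \<omega> $ snd e))
      (pairing_sum (\<lambda>k j. \<Sum>e\<in>P \<times> UNIV. of_real (1/4) * c k e * c j e) S)"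
    using indep gauss assms(3)
    by (intro wick_formula indep_quat_gaussian_mixed_moments) (auto simp: P_def H_def)
  moreover have "pairing_sum (\<lambda>k j. \<Sum>e\<in>P \<times> UNIV. of_real (1/4) * c k e * c j e) S =
      pairing_sum (ginibre_covariance N \<iota> \<eta>) S"
    by (intro pairing_sum_cong cov)
  moreover have "has_bochner_integral M (\<lambda>\<omega>. \<Prod>k\<in>S. quat_entry (Z (\<iota> k) (\<iota> (- k)) \<omega>) (\<eta> k) (\<eta> (- k))) x \<longleftrightarrow>
      has_bochner_integral M (\<lambda>\<omega>. \<Prod>k\<in>S. \<Sum>e\<in>P \<times> UNIV. c k e * of_real (H (fst e) \<omega> $ snd e)) x" for x
    by (intro has_bochner_integral_cong refl prod.cong entry)
  ultimately show ?thesis by simp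
qed

section \<open>Alternating pairings of signed indices\<close>

lemma orbit_involution:
  assumes "f (f x) = x"
  shows "orbit f x = {x, f x}"
proof
  show "orbit f x \<subseteq> {x, f x}"
  proof
    fix y assume "y \<in> orbit f x"
    then show "y \<in> {x, f x}" by induction (use assms in auto)
  qed
  have "f (f x) \<in> orbit f x" by (intro orbit.intros)
  then show "{x, f x} \<subseteq> orbit f x" using assms by (auto intro: orbit.intros)
qed

lemma ball_pm_set: "(\<forall>k\<in>pm_set n. P k) \<longleftrightarrow> (\<forall>k\<in>{1..int n}. P k \<and> P (- k))"
  unfolding pm_set_def by blast

text \<open>
  A pairing \<open>p\<close> of \<open>[n]\<close> becomes the involution of \<open>[n] \<union> -[n]\<close> with two-cycles \<open>(k, - p k)\<close>, two for each block.
\<close>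

definition alternating_lift :: "nat \<Rightarrow> (int \<Rightarrow> int) \<Rightarrow> int \<Rightarrow> int" where
  "alternating_lift n p k =
     (if k \<in> {1..int n} then - p k else if - k \<in> {1..int n} then p (- k) else k)"

lemma two_card_greater_partner:
  fixes S :: "'k::linorder set"
  assumes "finite S" "p \<in> pairing_involutions S"
  shows "2 * card {k \<in> S. p k < k} = card S"
proof -
  let ?A = "{k \<in> S. p k < k}" and ?B = "{k \<in> S. k < p k}"
  have "bij_betw p ?A ?B"
    by (rule bij_betw_byWitness[where f' = p]) (use assms in \<open>auto simp: pairing_involutions_def\<close>)
  then have "card ?A = card ?B" by (rule bij_betw_same_card)
  moreover have "S = ?A \<union> ?B" "?A \<inter> ?B = {}"
    using assms(2) by (auto simp: pairing_involutions_def)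
  then have "card S = card ?A + card ?B"
    using assms(1) by (metis card_Un_disjoint finite_Un)
  ultimately show ?thesis by simp
qed

text \<open>
  The lift of a pairing lies in the index set of the formula, and its statistics are those of the
  pairing: \<open>n\<close> cycles, and \<open>- k\<close> in the fundamental domain exactly when \<open>k\<close> is the larger element of
  its block.
\<close>

context
  fixes n :: nat and p \<alpha> :: "int \<Rightarrow> int"
  assumes p: "p \<in> pairing_involutions {1..int n}"
  defines "\<alpha> \<equiv> alternating_lift n p"
begin

lemma partner_facts:
  assumes "k \<in> {1..int n}"
  shows "p k \<in> {1..int n}" "p k \<noteq> k" "p (p k) = k"
  using p assms by (auto simp: pairing_involutions_def)

lemma alternating_lift_simps:
  assumes "k \<in> {1..int n}"
  shows "\<alpha> k = - p k" "\<alpha> (- k) = p k" "\<alpha> (p k) = - k" "\<alpha> (- p k) = k"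
  using assms partner_facts[OF assms] by (auto simp: \<alpha>_def alternating_lift_def)

lemma alternating_lift_involution: "\<alpha> (\<alpha> k) = k"
proof -
  consider "k \<in> {1..int n}" | "- k \<in> {1..int n}" | "k \<notin> {1..int n}" "- k \<notin> {1..int n}" by blast
  then show ?thesis
  proof cases
    case 1
    then show ?thesis by (simp add: alternating_lift_simps)
  next
    case 2
    then show ?thesis using alternating_lift_simps[OF 2] by simp
  next
    case 3
    then show ?thesis by (auto simp: \<alpha>_def alternating_lift_def)
  qed
qed

lemma orbit_alternating_lift: "orbit \<alpha> k = {k, \<alpha> k}"
  by (intro orbit_involution alternating_lift_involution)

lemma alternating_lift_permutes: "\<alpha> permutes pm_set n"
  unfolding permutes_def
proof (intro conjI allI impI)
  show "\<alpha> k = k" if "k \<notin> pm_set n" for k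
    using that by (auto simp: \<alpha>_def alternating_lift_def pm_set_def)
  show "\<exists>!x. \<alpha> x = y" for y
    by (metis alternating_lift_involution)
qed

lemma inv_alternating_lift: "inv \<alpha> = \<alpha>"
  by (rule inv_unique_comp) (auto simp: alternating_lift_involution)

lemma alternating_lift_uminus: "\<alpha> (- k) = - \<alpha> k"
  by (auto simp: \<alpha>_def alternating_lift_def)

lemma alternating_lift_in_PM: "\<alpha> \<in> PM n"
  unfolding PM_def mem_Collect_eq inv_alternating_lift ball_pm_set orbit_alternating_lift
  using partner_facts
  by (fastforce simp: alternating_lift_permutes alternating_lift_uminus alternating_lift_simps)

lemma alternating_lift_in_pairings: "\<alpha> \<in> pairings (pm_set n)"
  unfolding pairings_def mem_Collect_eq ball_pm_set orbit_alternating_lift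
  using partner_facts
  by (fastforce simp: alternating_lift_permutes alternating_lift_simps)

lemma alternating_lift_in_alternating_perms: "\<alpha> \<in> alternating_perms (pm_set n)"
  unfolding alternating_perms_def mem_Collect_eq ball_pm_set
  using partner_facts
  by (fastforce simp: alternating_lift_permutes alternating_lift_simps)

text \<open>
  Every cycle has exactly one positive element.
\<close>

lemma num_orbits_alternating_lift: "num_orbits n \<alpha> = n"
proof -
  have "orbit \<alpha> ` pm_set n = (\<lambda>k. {k, - p k}) ` {1..int n}"
  proof (intro equalityI subsetI)
    fix A assume "A \<in> orbit \<alpha> ` pm_set n"
    then obtain k where k: "k \<in> {1..int n}" "A = orbit \<alpha> k \<or> A = orbit \<alpha> (- k)"
      unfolding pm_set_def by blast
    then have "A = {k, - p k} \<or> A = {p k, - p (p k)}"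
      by (auto simp: orbit_alternating_lift alternating_lift_simps partner_facts)
    then show "A \<in> (\<lambda>k. {k, - p k}) ` {1..int n}"
      using k(1) partner_facts[OF k(1)] by blast
  next
    fix A assume "A \<in> (\<lambda>k. {k, - p k}) ` {1..int n}"
    then obtain k where "k \<in> {1..int n}" "A = orbit \<alpha> k"
      by (auto simp: orbit_alternating_lift alternating_lift_simps)
    then show "A \<in> orbit \<alpha> ` pm_set n" by (auto simp: pm_set_def)
  qed
  moreover have "inj_on (\<lambda>k. {k, - p k}) {1..int n}"
  proof (rule inj_onI)
    fix j k assume jk: "j \<in> {1..int n}" "k \<in> {1..int n}" "{j, - p j} = {k, - p k}"
    have "j \<noteq> - p k" using jk(1) partner_facts(1)[OF jk(2)] by auto
    then show "j = k" using jk(3) by blast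
  qed
  ultimately show ?thesis
    by (simp add: num_orbits_def card_image)
qed

text \<open>
  The cycle of \<open>- k\<close> is \<open>{- k, p k}\<close>, so its element of smallest absolute value is positive when
  \<open>p k\<close> is smaller than \<open>k\<close>.
\<close>

lemma uminus_in_FD_alternating_lift:
  assumes "k \<in> {1..int n}"
  shows "- k \<in> FD n \<alpha> \<longleftrightarrow> p k < k"
  using assms partner_facts[OF assms]
  unfolding FD_def mem_Collect_eq orbit_alternating_lift
  by (auto simp: pm_set_def alternating_lift_simps)

end

text \<open>
  An alternating pairing sends each \<open>k > 0\<close> to some \<open>- p k < 0\<close>. It is an involution, so the condition
  \<open>uminus \<circ> \<pi> \<circ> uminus = inv \<pi>\<close> says that it commutes with negation; hence \<open>p\<close> is an involution and determines
  \<open>\<pi>\<close> on the negative integers. The map \<open>p\<close> has no fixed point, as \<open>- k\<close> is not in the cycle of \<open>k\<close>.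
\<close>

lemma alternating_pairing_is_lift:
  assumes "\<alpha> \<in> PM n" "\<alpha> \<in> pairings (pm_set n)" "\<alpha> \<in> alternating_perms (pm_set n)"
  obtains p where "p \<in> pairing_involutions {1..int n}" "\<alpha> = alternating_lift n p"
proof -
  have perm: "\<alpha> permutes pm_set n" using assms(1) by (simp add: PM_def)
  have fin: "finite (pm_set n)" by (simp add: pm_set_def)
  have in_pm: "k \<in> pm_set n \<longleftrightarrow> k \<in> {1..int n} \<or> - k \<in> {1..int n}" for k
    by (auto simp: pm_set_def)
  have sgn: "sgn (\<alpha> k) = - sgn k" if "k \<in> pm_set n" for k
    using assms(3) that by (simp add: alternating_perms_def)
  have inv2: "\<alpha> (\<alpha> k) = k" if k: "k \<in> pm_set n" for k
  proof (rule ccontr)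
    assume ne: "\<alpha> (\<alpha> k) \<noteq> k"
    have "\<alpha> k \<noteq> k" using sgn[OF k] k by (auto simp: in_pm sgn_if split: if_splits)
    moreover from this have "\<alpha> (\<alpha> k) \<noteq> \<alpha> k"
      using perm by (simp add: permutes_inj inj_eq)
    ultimately have "card {k, \<alpha> k, \<alpha> (\<alpha> k)} = 3" using ne by auto
    moreover have "k \<in> orbit \<alpha> k"
      by (rule permutation_self_in_orbit) (use perm fin permutation_permutes in blast)
    then have "{k, \<alpha> k, \<alpha> (\<alpha> k)} \<subseteq> orbit \<alpha> k" by (auto intro: orbit.intros)
    moreover have "card (orbit \<alpha> k) = 2" using assms(2) k by (simp add: pairings_def)
    moreover from this have "finite (orbit \<alpha> k)" by (intro card_ge_0_finite) simp
    ultimately show False using card_mono[of "orbit \<alpha> k" "{k, \<alpha> k, \<alpha> (\<alpha> k)}"] by linarith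
  qed
  have "inv \<alpha> k = \<alpha> k" if "k \<in> pm_set n" for k
    using inv2[OF that] perm by (metis permutes_inverses(2))
  moreover have "uminus \<circ> \<alpha> \<circ> uminus = inv \<alpha>" using assms(1) by (simp add: PM_def)
  ultimately have neg: "\<alpha> (- k) = - \<alpha> k" if "k \<in> pm_set n" for k
    using that by (metis comp_apply minus_minus)
  have ne: "\<alpha> k \<noteq> - k" if "k \<in> pm_set n" for k
    using assms(1) that by (auto simp: PM_def) (metis orbit.base)
  define p where "p k = (if k \<in> {1..int n} then - \<alpha> k else k)" for k
  have pk: "- \<alpha> k \<in> {1..int n}" if "k \<in> {1..int n}" for k
  proof -
    have k: "k \<in> pm_set n" using that in_pm by simp
    then have "\<alpha> k \<in> pm_set n" using permutes_in_image[OF perm] by simp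
    moreover have "\<alpha> k < 0" using sgn[OF k] that by (simp add: sgn_if split: if_splits)
    ultimately show ?thesis by (auto simp: in_pm)
  qed
  have "p \<in> pairing_involutions {1..int n}"
    unfolding pairing_involutions_def mem_Collect_eq
  proof (intro conjI allI impI ballI)
    fix k assume k: "k \<in> {1..int n}"
    then have k': "k \<in> pm_set n" using in_pm by simp
    have ak: "\<alpha> k \<in> pm_set n" using permutes_in_image[OF perm] k' by simp
    show "p k \<in> {1..int n}" using k pk[OF k] by (simp add: p_def)
    show "p k \<noteq> k" using k ne[OF k'] by (auto simp: p_def)
    show "p (p k) = k" using k pk[OF k] neg[OF ak] inv2[OF k'] by (simp add: p_def)
  qed (auto simp: p_def)
  moreover have "\<alpha> = alternating_lift n p"
  proof
    fix k
    show "\<alpha> k = alternating_lift n p k"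
      using neg[of "- k"] permutes_not_in[OF perm, of k] in_pm[of k] in_pm[of "- k"]
      by (auto simp: alternating_lift_def p_def)
  qed
  ultimately show ?thesis using that by blast
qed

lemma inj_on_alternating_lift: "inj_on (alternating_lift n) (pairing_involutions {1..int n})"
proof (rule inj_onI, rule ext)
  fix p q k
  assume pq: "p \<in> pairing_involutions {1..int n}" "q \<in> pairing_involutions {1..int n}"
    "alternating_lift n p = alternating_lift n q"
  show "p k = q k"
  proof (cases "k \<in> {1..int n}")
    case True
    then show ?thesis
      using fun_cong[OF pq(3), of k] by (auto simp: alternating_lift_def)
  next
    case False
    then show ?thesis using pq(1,2) by (simp add: pairing_involutions_def)
  qed
qed

lemma alternating_pairings_eq_lift:
  "PM n \<inter> pairings (pm_set n) \<inter> alternating_perms (pm_set n) =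
   alternating_lift n ` pairing_involutions {1..int n}"
  using alternating_lift_in_PM alternating_lift_in_pairings alternating_lift_in_alternating_perms
  by (auto elim!: alternating_pairing_is_lift)

section \<open>The moments of the Ginibre matrix\<close>

text \<open>
  As \<open>k\<close> and its image have opposite signs, the sign-twisted condition on \<open>\<eta>\<close> says that \<open>\<eta>\<close> changes
  sign between partners, on the rows and on the columns.
\<close>

lemma alternating_lift_compatible_iff:
  assumes p: "p \<in> pairing_involutions {1..int n}"
  shows "(\<forall>k\<in>pm_set n. \<iota> k = \<iota> (- alternating_lift n p k)) \<and>
         (\<forall>k\<in>pm_set n. sgn k * \<eta> k = sgn (alternating_lift n p k) * \<eta> (- alternating_lift n p k)) \<longleftrightarrow>
         (\<forall>k\<in>{1..int n}. \<iota> k = \<iota> (p k) \<and> \<iota> (- k) = \<iota> (- p k) \<and>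
                         \<eta> (p k) = - \<eta> k \<and> \<eta> (- p k) = - \<eta> (- k))"
proof -
  have "\<iota> k = \<iota> (- alternating_lift n p k) \<and> \<iota> (- k) = \<iota> (- alternating_lift n p (- k)) \<and>
        sgn k * \<eta> k = sgn (alternating_lift n p k) * \<eta> (- alternating_lift n p k) \<and>
        sgn (- k) * \<eta> (- k) = sgn (alternating_lift n p (- k)) * \<eta> (- alternating_lift n p (- k)) \<longleftrightarrow>
        \<iota> k = \<iota> (p k) \<and> \<iota> (- k) = \<iota> (- p k) \<and> \<eta> (p k) = - \<eta> k \<and> \<eta> (- p k) = - \<eta> (- k)"
    if k: "k \<in> {1..int n}" for k
    using k partner_facts(1)[OF p k] by (auto simp: alternating_lift_simps[OF p k] sgn_if)
  then show ?thesis unfolding ball_pm_set by blast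
qed

text \<open>
  A pairing has \<open>n / 2\<close> blocks, each contributing a factor \<open>1 / (2 N)\<close>, in agreement with the exponent
  \<open>n / 2 - n\<close> that comes from \<open>n\<close> cycles.
\<close>

lemma prod_ginibre_covariance:
  assumes p: "p \<in> pairing_involutions {1..int n}" and "N > 0"
  shows "(\<Prod>k | k \<in> {1..int n} \<and> p k < k. ginibre_covariance N \<iota> \<eta> k (p k)) =
     (if \<forall>k\<in>{1..int n}. \<iota> k = \<iota> (p k) \<and> \<iota> (- k) = \<iota> (- p k) \<and>
                         \<eta> (p k) = - \<eta> k \<and> \<eta> (- p k) = - \<eta> (- k)
      then (\<Prod>k | k \<in> {1..int n} \<and> p k < k. of_int (\<eta> k * \<eta> (- k))) *
           complex_of_real ((2 * real N) powr (real n / 2 - real n))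
      else 0)"
    (is "?L = (if ?C then ?R else 0)")
proof (cases ?C)
  case True
  let ?A = "{k \<in> {1..int n}. p k < k}"
  have "real n = 2 * real (card ?A)"
    using two_card_greater_partner[OF _ p] by simp
  then have "(2 * real N) powr (real n / 2 - real n) = (2 * real N) powr (- real (card ?A))"
    by simp
  also have "\<dots> = 1 / (2 * real N) ^ card ?A"
    using \<open>N > 0\<close> by (simp add: powr_minus powr_realpow divide_inverse)
  finally have "?R = (\<Prod>k\<in>?A. of_int (\<eta> k * \<eta> (- k))) * (1 / of_nat (2 * N)) ^ card ?A"
    by (simp add: power_divide)
  also have "\<dots> = (\<Prod>k\<in>?A. of_int (\<eta> k * \<eta> (- k)) * (1 / of_nat (2 * N)))"
    by (simp only: prod.distrib prod_constant)
  also have "\<dots> = ?L"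
    using True by (intro prod.cong refl) (simp add: ginibre_covariance_def)
  finally show ?thesis using True by simp
next
  case False
  then obtain k where k: "k \<in> {1..int n}"
    and bad: "\<not> (\<iota> k = \<iota> (p k) \<and> \<iota> (- k) = \<iota> (- p k) \<and> \<eta> (p k) = - \<eta> k \<and> \<eta> (- p k) = - \<eta> (- k))"
    by blast
  note pk = partner_facts[OF p k]
  \<comment> \<open>The product runs over larger elements, and a violation at \<open>k\<close> is also one at its partner.\<close>
  define l where "l = max k (p k)"
  have "l = k \<or> l = p k" by (auto simp: l_def max_def)
  moreover have "p l < l" using pk by (auto simp: l_def max_def)
  moreover have "ginibre_covariance N \<iota> \<eta> l (p l) = 0"
    using \<open>l = k \<or> l = p k\<close> bad pk(3) by (auto simp: ginibre_covariance_def)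
  ultimately have "\<exists>l\<in>{k \<in> {1..int n}. p k < k}. ginibre_covariance N \<iota> \<eta> l (p l) = 0"
    using k pk(1) by blast
  then have "?L = 0" by (rule prod_zero[rotated]) (rule finite_subset[of _ "{1..int n}"], auto)
  then show ?thesis unfolding if_not_P[OF False] .
qed

theorem proposition5p4:
  fixes M :: "'a measure" and N n :: nat
    and Z :: "nat \<Rightarrow> nat \<Rightarrow> 'a \<Rightarrow> quat"
    and \<iota> :: "int \<Rightarrow> nat" and \<eta> :: "int \<Rightarrow> int"
  assumes "prob_space M"
    and "quat_ginibre M N Z"
    and "n \<ge> 1"
    and "\<forall>k\<in>pm_set n. \<iota> k \<in> {1..N}"
    and "\<forall>k\<in>pm_set n. \<eta> k \<in> {1, -1}"
  shows "integrable M (\<lambda>\<omega>. \<Prod>k\<in>{1..int n}. quat_entry (Z (\<iota> k) (\<iota> (- k)) \<omega>) (\<eta> k) (\<eta> (- k))) \<and>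
    prob_space.expectation M
      (\<lambda>\<omega>. \<Prod>k\<in>{1..int n}. quat_entry (Z (\<iota> k) (\<iota> (- k)) \<omega>) (\<eta> k) (\<eta> (- k))) =
    (\<Sum>\<alpha> | \<alpha> \<in> PM n \<and>
        (\<forall>k\<in>pm_set n. \<iota> k = \<iota> (- \<alpha> k)) \<and>
        (\<forall>k\<in>pm_set n. sgn k * \<eta> k = sgn (\<alpha> k) * \<eta> (- \<alpha> k)).
      (\<Prod>k | k \<in> {1..int n} \<and> - k \<in> FD n \<alpha>. of_int (\<eta> k * \<eta> (- k))) *
      complex_of_real ((2 * real N) powr (real (num_orbits n \<alpha>) / 2 - real n)) *
      ginibre_f n \<alpha>)"
proof -
  let ?S = "{1..int n}" and ?f = "alternating_lift n"
  define compat where "compat \<alpha> \<longleftrightarrow> (\<forall>k\<in>pm_set n. \<iota> k = \<iota> (- \<alpha> k)) \<and>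
      (\<forall>k\<in>pm_set n. sgn k * \<eta> k = sgn (\<alpha> k) * \<eta> (- \<alpha> k))" for \<alpha>
  define t where "t \<alpha> = (\<Prod>k | k \<in> ?S \<and> - k \<in> FD n \<alpha>. of_int (\<eta> k * \<eta> (- k))) *
      complex_of_real ((2 * real N) powr (real (num_orbits n \<alpha>) / 2 - real n))" for \<alpha>
  have "finite (pm_set n)" by (simp add: pm_set_def)
  then have "finite {\<pi>. \<pi> permutes pm_set n}" by (rule finite_permutations)
  then have fin: "finite (PM n)" by (rule rev_finite_subset) (auto simp: PM_def)
  have "1 \<in> pm_set n" using assms(3) by (simp add: pm_set_def)
  then have N: "N > 0" using assms(4) by fastforce
  have t_lift: "(\<Prod>k | k \<in> ?S \<and> p k < k. ginibre_covariance N \<iota> \<eta> k (p k)) =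
      (if compat (?f p) then t (?f p) else 0)" if p: "p \<in> pairing_involutions ?S" for p
  proof -
    have "{k \<in> ?S. - k \<in> FD n (?f p)} = {k \<in> ?S. p k < k}"
      using uminus_in_FD_alternating_lift[OF p] by blast
    then show ?thesis
      unfolding compat_def alternating_lift_compatible_iff[OF p] t_def
        num_orbits_alternating_lift[OF p] prod_ginibre_covariance[OF p N] by simp
  qed
  have "(\<Sum>\<alpha> | \<alpha> \<in> PM n \<and> compat \<alpha>. t \<alpha> * ginibre_f n \<alpha>) =
        (\<Sum>\<alpha>\<in>PM n. if compat \<alpha> then t \<alpha> * ginibre_f n \<alpha> else 0)"
    using fin by (rule sum.inter_filter)
  also have "\<dots> = (\<Sum>\<alpha>\<in>PM n \<inter> pairings (pm_set n) \<inter> alternating_perms (pm_set n).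
                     if compat \<alpha> then t \<alpha> else 0)"
    using fin by (intro sum.mono_neutral_cong_right) (auto simp: ginibre_f_def)
  also have "\<dots> = (\<Sum>p\<in>pairing_involutions ?S. if compat (?f p) then t (?f p) else 0)"
    unfolding alternating_pairings_eq_lift by (simp add: sum.reindex[OF inj_on_alternating_lift])
  also have "\<dots> = pairing_sum (ginibre_covariance N \<iota> \<eta>) ?S"
    unfolding pairing_sum_def by (intro sum.cong refl t_lift[symmetric])
  finally have rhs: "(\<Sum>\<alpha> | \<alpha> \<in> PM n \<and> compat \<alpha>. t \<alpha> * ginibre_f n \<alpha>) =
      pairing_sum (ginibre_covariance N \<iota> \<eta>) ?S" .
  have "has_bochner_integral M
      (\<lambda>\<omega>. \<Prod>k\<in>?S. quat_entry (Z (\<iota> k) (\<iota> (- k)) \<omega>) (\<eta> k) (\<eta> (- k)))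
      (pairing_sum (ginibre_covariance N \<iota> \<eta>) ?S)"
    using assms(4,5) unfolding ball_pm_set by (intro ginibre_wick[OF assms(1,2)]) auto
  then show ?thesis
    unfolding rhs[symmetric] has_bochner_integral_iff compat_def t_def by simp
qed

end
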